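(* Let $\mathcal{A}$ be a unital associative algebra over $\mathbb{Q}$, $\mathcal{C}\subseteq\mathcal{A}$ a commutative subalgebra, $\mathcal{I}$ the Lie idealiser of $\mathcal{C}$ in $\mathcal{A}$, and $d\in\mathcal{I}\setminus\mathcal{C}$. Then the linear space $\mathfrak{F}$ is an associative algebra, with $$\langle x\rangle_k\cdot\langle y\rangle_l=\sum_{n=0}^{k+l}\langle z_n\rangle_{k+l-n}\qquad (x,y\in\mathcal{C},\ k,l\ge 0),$$ where the terms $$z_n=\sum_{i=0}^{n}\pi_{n,i}^{k,l}\,(D^i x)(D^{n-i}y)$$ are in $\mathcal{C}$ and $\pi_{n,i}^{k,l}\in\mathbb{Q}$.
   Context: The commutator is $[a,b]=a\cdot b-b\cdot a$. The Lie idealiser of $\mathcal{C}$ in $\mathcal{A}$ is $\mathcal{I}=\{d\in\mathcal{A}: [d,\mathcal{C}]\subseteq\mathcal{C}\}$. For the fixed $d\in\mathcal{I}\setminus\mathcal{C}$, $D=\mathrm{ad}_d$, $D(a)=[d,a]$, which maps $\mathcal{C}$ to $\mathcal{C}$; $D^i$ is its $i$-th iterate, $D^0=\mathrm{id}$. For $x\in\mathcal{C}$ and an integer $k\ge 0$, $\langle x\rangle_k=\tfrac12(x\cdot d^k+d^k\cdot x)$, with $d^0=1_{\mathcal{A}}$. For each $k\ge 0$, $\mathfrak{F}_k$ is the linear space $\{\langle x\rangle_k: x\in\mathcal{C}\}$, and $\mathfrak{F}=\bigoplus_{k\ge 0}\mathfrak{F}_k$ denotes the direct sum of these linear spaces.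 *)

theory Defs
  imports Complex_Main
begin

locale rat_algebra = vector_space scale
  for scale :: "rat \<Rightarrow> 'a::ring_1 \<Rightarrow> 'a" +
  assumes scale_mult_left: "scale r x * y = scale r (x * y)"
    and scale_mult_right: "x * scale r y = scale r (x * y)"

text \<open>A subalgebra need not contain the unit of the ambient algebra.\<close>

definition rat_subalgebra :: "(rat \<Rightarrow> 'a::ring_1 \<Rightarrow> 'a) \<Rightarrow> 'a set \<Rightarrow> bool" where
  "rat_subalgebra scale S \<longleftrightarrow> module.subspace scale S \<and> (\<forall>x\<in>S. \<forall>y\<in>S. x * y \<in> S)"

definition commutative_subalgebra :: "(rat \<Rightarrow> 'a::ring_1 \<Rightarrow> 'a) \<Rightarrow> 'a set \<Rightarrow> bool" where
  "commutative_subalgebra scale C \<longleftrightarrow>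
     rat_subalgebra scale C \<and> (\<forall>x\<in>C. \<forall>y\<in>C. x * y = y * x)"

definition commutator :: "'a::ring_1 \<Rightarrow> 'a \<Rightarrow> 'a" where
  "commutator a b = a * b - b * a"

definition lie_idealiser :: "'a::ring_1 set \<Rightarrow> 'a set" where
  "lie_idealiser C = {d. \<forall>c\<in>C. commutator d c \<in> C}"

definition ad :: "'a::ring_1 \<Rightarrow> 'a \<Rightarrow> 'a" where
  "ad d = (\<lambda>a. commutator d a)"

definition sym_term :: "(rat \<Rightarrow> 'a::ring_1 \<Rightarrow> 'a) \<Rightarrow> 'a \<Rightarrow> 'a \<Rightarrow> nat \<Rightarrow> 'a" where
  "sym_term scale d x k = scale (1/2) (x * d ^ k + d ^ k * x)"

definition sym_space :: "(rat \<Rightarrow> 'a::ring_1 \<Rightarrow> 'a) \<Rightarrow> 'a set \<Rightarrow> 'a \<Rightarrow> nat \<Rightarrow> 'a set" where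
  "sym_space scale C d k = {sym_term scale d x k | x. x \<in> C}"

text \<open>
  The sum of the spaces \<open>sym_space scale C d k\<close> over all \<open>k\<close>, formed inside the ambient
  algebra: every finitely supported family \<open>f\<close> with \<open>f k\<close> in the \<open>k\<close>-th space contributes
  the element \<open>\<Sum>k. f k\<close>. When the spaces are independent, this is their (internal) direct
  sum. They need not be: for the 2 by 2 matrices, the scalar matrices as \<open>C\<close> and a
  non-scalar \<open>d\<close> with \<open>d\<^sup>2 = 1\<close>, the spaces for \<open>k = 0\<close> and \<open>k = 2\<close> coincide.
\<close>

definition sym_sum :: "(rat \<Rightarrow> 'a::ring_1 \<Rightarrow> 'a) \<Rightarrow> 'a set \<Rightarrow> 'a \<Rightarrow> 'a set" where
  "sym_sum scale C d =
     {\<Sum>k | f k \<noteq> 0. f k | f. (\<forall>k. f k \<in> sym_space scale C d k) \<and> finite {k. f k \<noteq> 0}}"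

end

theory Submission
  imports Defs
begin

text \<open>
  Write \<open>m = k + l\<close>. The product of two symmetric terms is a quarter of the sum of four words
  \<open>d\<^sup>a x d\<^sup>b y d\<^sup>c\<close> with \<open>a + b + c = m\<close>. Moving one \<open>d\<close> across a form \<open>z\<close> of degree \<open>n\<close> in
  \<open>x\<close>, \<open>y\<close> and their iterated derivatives costs \<open>D z\<close>, a form of degree \<open>n + 1\<close> with one power of
  \<open>d\<close> less. So, by induction on the number of powers of \<open>d\<close>, all words \<open>d\<^sup>a z d\<^sup>b\<close> with the same
  \<open>a + b\<close> agree modulo sums of symmetric terms of lower order; the average of the words
  \<open>z d\<^bsup>a+b\<^esup>\<close> and \<open>d\<^bsup>a+b\<^esup> z\<close> is itself a symmetric term, hence so is each word up to such sums.
\<close>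

section \<open>Derivation rules and linearity\<close>

lemma ad_eq: "ad d a = d * a - a * d"
  by (simp add: ad_def commutator_def)

lemma ad_mult: "ad d (a * b) = ad d a * b + a * ad d b"
  by (simp add: ad_eq algebra_simps)

lemma ad_sum: "ad d (\<Sum>i\<in>A. f i) = (\<Sum>i\<in>A. ad d (f i))"
  by (simp add: ad_eq sum_distrib_left sum_distrib_right sum_subtractf)

text \<open>This is \<open>d * z = z * d + ad d z\<close>, placed between powers of
  \<open>d\<close>.\<close>

lemma power_Suc_mult_eq_ad:
  "d ^ Suc a * z * d ^ b = d ^ a * z * d ^ Suc b + d ^ a * ad d z * d ^ b"
  unfolding ad_eq power_Suc2[of d a] power_Suc[of d b] by (simp add: algebra_simps)

context rat_algebra
begin

lemma ad_scale: "ad d (scale r a) = scale r (ad d a)"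
  by (simp add: ad_eq scale_mult_left scale_mult_right scale_right_diff_distrib)

lemma sym_term_0: "sym_term scale d 0 k = 0"
  by (simp add: sym_term_def)

lemma sym_term_add: "sym_term scale d (x + y) k = sym_term scale d x k + sym_term scale d y k"
  by (simp add: sym_term_def algebra_simps flip: scale_right_distrib)

lemma sym_term_scale: "sym_term scale d (scale r x) k = scale r (sym_term scale d x k)"
  by (simp add: sym_term_def scale_mult_left scale_mult_right mult.commute
      flip: scale_right_distrib)

section \<open>Homogeneous bilinear differential forms\<close>

text \<open>A form is a function of \<open>x\<close> and \<open>y\<close>, so that its coefficients
  \<open>p\<close> are fixed before the arguments are.\<close>

definition diff_form :: "'a \<Rightarrow> nat \<Rightarrow> ('a \<Rightarrow> 'a \<Rightarrow> 'a) \<Rightarrow> bool" where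
  "diff_form d n z \<longleftrightarrow>
     (\<exists>p. z = (\<lambda>x y. \<Sum>i\<le>n. scale (p i) ((ad d ^^ i) x * (ad d ^^ (n - i)) y)))"

lemma diff_form_0: "diff_form d n (\<lambda>x y. 0)"
  unfolding diff_form_def by (rule exI[of _ "\<lambda>_. 0"]) simp

lemma diff_form_add:
  assumes "diff_form d n z" "diff_form d n w"
  shows "diff_form d n (\<lambda>x y. z x y + w x y)"
proof -
  obtain p q where
    "z = (\<lambda>x y. \<Sum>i\<le>n. scale (p i) ((ad d ^^ i) x * (ad d ^^ (n - i)) y))"
    "w = (\<lambda>x y. \<Sum>i\<le>n. scale (q i) ((ad d ^^ i) x * (ad d ^^ (n - i)) y))"
    using assms unfolding diff_form_def by blast
  then show ?thesis
    unfolding diff_form_def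
    by (intro exI[of _ "\<lambda>i. p i + q i"]) (simp add: scale_left_distrib sum.distrib)
qed

lemma diff_form_scale:
  assumes "diff_form d n z"
  shows "diff_form d n (\<lambda>x y. scale r (z x y))"
proof -
  obtain p where
    "z = (\<lambda>x y. \<Sum>i\<le>n. scale (p i) ((ad d ^^ i) x * (ad d ^^ (n - i)) y))"
    using assms unfolding diff_form_def by blast
  then show ?thesis
    unfolding diff_form_def
    by (intro exI[of _ "\<lambda>i. r * p i"]) (simp add: scale_sum_right)
qed

lemma diff_form_sum:
  assumes "\<And>i. i \<in> A \<Longrightarrow> diff_form d n (z i)"
  shows "diff_form d n (\<lambda>x y. \<Sum>i\<in>A. z i x y)"
  using assms
  by (induction A rule: infinite_finite_induct) (auto intro: diff_form_0 diff_form_add)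

lemma diff_form_monomial: "diff_form d (i + j) (\<lambda>x y. (ad d ^^ i) x * (ad d ^^ j) y)"
proof -
  have "(\<Sum>h\<le>i + j. scale (if h = i then 1 else 0) ((ad d ^^ h) x * (ad d ^^ (i + j - h)) y))
      = (ad d ^^ i) x * (ad d ^^ j) y" for x y
    by (simp add: if_distrib[of "\<lambda>r. scale r _"] cong: if_cong)
  then show ?thesis
    unfolding diff_form_def by (intro exI[of _ "\<lambda>h. if h = i then 1 else 0"]) presburger
qed

text \<open>By the Leibniz rule each monomial of degree \<open>n\<close> turns into two of degree
  \<open>n + 1\<close>.\<close>

lemma diff_form_ad:
  assumes "diff_form d n z"
  shows "diff_form d (Suc n) (\<lambda>x y. ad d (z x y))"
proof -
  obtain p where z: "z = (\<lambda>x y. \<Sum>i\<le>n. scale (p i) ((ad d ^^ i) x * (ad d ^^ (n - i)) y))"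
    using assms unfolding diff_form_def by blast
  have "diff_form d (Suc n) (\<lambda>x y. (ad d ^^ Suc i) x * (ad d ^^ (n - i)) y
      + (ad d ^^ i) x * (ad d ^^ Suc (n - i)) y)" if "i \<le> n" for i
    using diff_form_monomial[of d "Suc i" "n - i"] diff_form_monomial[of d i "Suc (n - i)"] that
    by (intro diff_form_add) simp_all
  then have "diff_form d (Suc n) (\<lambda>x y. \<Sum>i\<le>n. scale (p i)
      ((ad d ^^ Suc i) x * (ad d ^^ (n - i)) y + (ad d ^^ i) x * (ad d ^^ Suc (n - i)) y))"
    by (intro diff_form_sum diff_form_scale) simp
  then show ?thesis
    by (simp add: z ad_sum ad_scale ad_mult)
qed

section \<open>Sums of symmetric terms of fixed weight\<close>

text \<open>The weight \<open>m\<close> counts the derivatives and the powers of \<open>d\<close>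
  together; exchanging a \<open>d\<close> for a derivative preserves it.\<close>

definition sym_form :: "'a \<Rightarrow> nat \<Rightarrow> ('a \<Rightarrow> 'a \<Rightarrow> 'a) \<Rightarrow> bool" where
  "sym_form d m F \<longleftrightarrow> (\<exists>z. (\<forall>n. diff_form d n (z n)) \<and>
     F = (\<lambda>x y. \<Sum>n\<le>m. sym_term scale d (z n x y) (m - n)))"

lemma sym_form_add:
  assumes "sym_form d m F" "sym_form d m G"
  shows "sym_form d m (\<lambda>x y. F x y + G x y)"
proof -
  obtain z w where "\<And>n. diff_form d n (z n)" "\<And>n. diff_form d n (w n)"
    and "F = (\<lambda>x y. \<Sum>n\<le>m. sym_term scale d (z n x y) (m - n))"
    and "G = (\<lambda>x y. \<Sum>n\<le>m. sym_term scale d (w n x y) (m - n))"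
    using assms unfolding sym_form_def by blast
  then show ?thesis
    unfolding sym_form_def
    by (intro exI[of _ "\<lambda>n x y. z n x y + w n x y"])
      (simp add: sym_term_add sum.distrib diff_form_add)
qed

lemma sym_form_scale:
  assumes "sym_form d m F"
  shows "sym_form d m (\<lambda>x y. scale r (F x y))"
proof -
  obtain z where "\<And>n. diff_form d n (z n)"
    and "F = (\<lambda>x y. \<Sum>n\<le>m. sym_term scale d (z n x y) (m - n))"
    using assms unfolding sym_form_def by blast
  then show ?thesis
    unfolding sym_form_def
    by (intro exI[of _ "\<lambda>n x y. scale r (z n x y)"])
      (simp add: sym_term_scale scale_sum_right diff_form_scale)
qed

lemma sym_form_sym_term:
  assumes "diff_form d n z"
  shows "sym_form d (n + j) (\<lambda>x y. sym_term scale d (z x y) j)"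
proof -
  define w where "w i = (if i = n then z else (\<lambda>x y. 0))" for i
  have "diff_form d i (w i)" for i
    using assms by (simp add: w_def diff_form_0)
  moreover have "(\<Sum>i\<le>n + j. sym_term scale d (w i x y) (n + j - i)) = sym_term scale d (z x y) j"
    for x y
    by (subst sum.remove[of _ n]) (auto simp: w_def sym_term_0 intro!: sum.neutral)
  ultimately show ?thesis
    unfolding sym_form_def by (intro exI[of _ w]) simp
qed

lemma half_plus_half: "scale (1/2) a + scale (1/2) a = a"
  by (simp flip: scale_left_distrib)

section \<open>Rewriting words as sums of symmetric terms\<close>

lemma sym_form_word:
  assumes "diff_form d n z" "a + b = N"
  shows "sym_form d (n + N) (\<lambda>x y. d ^ a * z x y * d ^ b)"
  using assms
proof (induction N arbitrary: n z a b)
  case 0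
  then show ?case
    using sym_form_sym_term[of d n z 0] by (simp add: sym_term_def scale_right_distrib half_plus_half)
next
  case (Suc N)
  define W where "W e x y = d ^ e * z x y * d ^ (Suc N - e)" for e x y
  \<comment> \<open>The index \<open>e\<close> counts the powers of \<open>d\<close> to the left of
    \<open>z\<close>. Raising it by one costs a word in \<open>ad d z\<close> with \<open>N\<close>
    powers of \<open>d\<close>, which the outer induction hypothesis covers, as
    \<open>Suc n + N = n + Suc N\<close>.\<close>
  have move: "sym_form d (n + Suc N) (\<lambda>x y. W e x y - W 0 x y)" if "e \<le> Suc N" for e
    using that
  proof (induction e)
    case 0
    show ?case
      \<comment> \<open>The zero function is written as \<open>0\<close> times a symmetric term of
        the right weight.\<close>
      using sym_form_scale[OF sym_form_sym_term[OF Suc.prems(1), of "Suc N"], of 0] by simp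
  next
    case step: (Suc e)
    have "sym_form d (n + Suc N) (\<lambda>x y. d ^ e * ad d (z x y) * d ^ (N - e))"
      using Suc.IH[OF diff_form_ad[OF Suc.prems(1)], of e "N - e"] step.prems by simp
    moreover have "W (Suc e) x y = W e x y + d ^ e * ad d (z x y) * d ^ (N - e)" for x y
      using power_Suc_mult_eq_ad[of d e "z x y" "N - e"] step.prems
      unfolding W_def by (simp only: diff_Suc_Suc Suc_diff_le Suc_le_mono)
    ultimately show ?case
      using sym_form_add[OF step.IH] step.prems by (simp add: diff_add_eq)
  qed
  \<comment> \<open>The symmetric term is the mean of \<open>W 0\<close> and
    \<open>W (Suc N)\<close>, that is, \<open>W 0\<close> plus half of
    \<open>W (Suc N) - W 0\<close>. Solving for \<open>W 0\<close> leaves only differences of the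
    kind treated in \<open>move\<close>.\<close>
  have "W a x y = (sym_term scale d (z x y) (Suc N) + (W a x y - W 0 x y))
      + scale (-1/2) (W (Suc N) x y - W 0 x y)" for x y
    using half_plus_half[of "W 0 x y"]
    by (simp add: W_def sym_term_def algebra_simps del: power_Suc)
  moreover have "sym_form d (n + Suc N) (\<lambda>x y.
      (sym_term scale d (z x y) (Suc N) + (W a x y - W 0 x y))
      + scale (-1/2) (W (Suc N) x y - W 0 x y))"
    using Suc.prems
    by (intro sym_form_add sym_form_scale sym_form_sym_term move) auto
  ultimately have "sym_form d (n + Suc N) (W a)"
    by presburger
  moreover have "W a = (\<lambda>x y. d ^ a * z x y * d ^ b)"
    using Suc.prems(2) unfolding W_def by (intro ext) (metis add_diff_cancel_left')
  ultimately show ?case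
    by simp
qed

text \<open>The inner powers of \<open>d\<close> are moved to the right across the second factor one
  at a time. Each move raises either \<open>c\<close> or \<open>j\<close> by one, hence both vary in
  the induction; once \<open>b = 0\<close>, the two factors form a single monomial.\<close>

lemma sym_form_word2:
  "sym_form d (a + i + b + j + c)
     (\<lambda>x y. d ^ a * (ad d ^^ i) x * d ^ b * (ad d ^^ j) y * d ^ c)"
proof (induction b arbitrary: j c)
  case 0
  show ?case
    using sym_form_word[OF diff_form_monomial[of d i j] refl, of a c]
    by (simp add: ac_simps)
next
  case (Suc b)
  have "d ^ a * (ad d ^^ i) x * d ^ Suc b * (ad d ^^ j) y * d ^ c
      = d ^ a * (ad d ^^ i) x * d ^ b * (ad d ^^ j) y * d ^ Suc c
      + d ^ a * (ad d ^^ i) x * d ^ b * (ad d ^^ Suc j) y * d ^ c" for x y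
    using arg_cong[OF power_Suc_mult_eq_ad[of d b "(ad d ^^ j) y" c],
        of "\<lambda>u. d ^ a * (ad d ^^ i) x * u"]
    by (simp add: distrib_left mult.assoc del: power_Suc)
  then show ?case
    using sym_form_add Suc.IH[of j "Suc c"] Suc.IH[of "Suc j" c]
    by (simp only: add_Suc_right add_Suc)
qed

lemma sym_form_prod: "sym_form d (k + l) (\<lambda>x y. sym_term scale d x k * sym_term scale d y l)"
proof -
  \<comment> \<open>The factors \<open>d ^ 0\<close> give all four words the shape treated in
    \<open>sym_form_word2\<close>.\<close>
  have "sym_term scale d x k * sym_term scale d y l =
      scale (1/4) ((d ^ 0 * x * d ^ k * y * d ^ l + d ^ 0 * x * d ^ (k + l) * y * d ^ 0)
        + (d ^ k * x * d ^ 0 * y * d ^ l + d ^ k * x * d ^ l * y * d ^ 0))" for x y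
    by (simp add: sym_term_def scale_mult_left scale_mult_right algebra_simps power_add)
  moreover have "sym_form d (k + l) (\<lambda>x y.
      scale (1/4) ((d ^ 0 * x * d ^ k * y * d ^ l + d ^ 0 * x * d ^ (k + l) * y * d ^ 0)
        + (d ^ k * x * d ^ 0 * y * d ^ l + d ^ k * x * d ^ l * y * d ^ 0)))"
    using sym_form_word2[of d 0 0 k 0 l] sym_form_word2[of d 0 0 "k + l" 0 0]
      sym_form_word2[of d k 0 0 0 l] sym_form_word2[of d k 0 l 0 0]
    by (intro sym_form_scale sym_form_add) simp_all
  ultimately show ?thesis
    by presburger
qed

text \<open>Since \<open>sym_form_prod\<close> gives an equality of functions of \<open>x\<close>
  and \<open>y\<close>, choice over \<open>n\<close> and then over \<open>k\<close> and
  \<open>l\<close> yields coefficients that do not depend on \<open>x\<close> and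
  \<open>y\<close>.\<close>

lemma sym_term_prod_expansion:
  "\<exists>\<pi>. \<forall>k l x y. sym_term scale d x k * sym_term scale d y l =
    (\<Sum>n\<le>k + l. sym_term scale d
      (\<Sum>i\<le>n. scale (\<pi> k l n i) ((ad d ^^ i) x * (ad d ^^ (n - i)) y)) (k + l - n))"
proof -
  define Q where "Q k l p \<longleftrightarrow> (\<forall>x y. sym_term scale d x k * sym_term scale d y l =
    (\<Sum>n\<le>k + l. sym_term scale d
      (\<Sum>i\<le>n. scale (p n i) ((ad d ^^ i) x * (ad d ^^ (n - i)) y)) (k + l - n)))" for k l p
  have "\<exists>p. Q k l p" for k l
  proof -
    obtain z where z: "\<And>n. diff_form d n (z n)"
      and prod: "(\<lambda>x y. sym_term scale d x k * sym_term scale d y l) =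
        (\<lambda>x y. \<Sum>n\<le>k + l. sym_term scale d (z n x y) (k + l - n))"
      using sym_form_prod[of d k l] unfolding sym_form_def by blast
    obtain p where p: "\<forall>n. z n =
        (\<lambda>x y. \<Sum>i\<le>n. scale (p n i) ((ad d ^^ i) x * (ad d ^^ (n - i)) y))"
      using choice[OF allI[OF z[unfolded diff_form_def]]] by (rule exE)
    show ?thesis
      unfolding Q_def
      by (intro exI[of _ p] allI) (rule fun_cong[OF fun_cong[OF prod[unfolded p[rule_format]]]])
  qed
  then have "\<exists>\<pi>. \<forall>k l. Q k l (\<pi> k l)"
    by metis
  then show ?thesis
    unfolding Q_def .
qed

section \<open>Membership in \<open>C\<close> and closure under products\<close>

text \<open>An element of the idealiser makes \<open>C\<close> invariant under \<open>ad d\<close>,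
  so all iterated derivatives stay in \<open>C\<close>.\<close>

lemma diff_form_mem:
  assumes "rat_subalgebra scale C" "d \<in> lie_idealiser C" "x \<in> C" "y \<in> C"
  shows "(\<Sum>i\<le>n. scale (p i) ((ad d ^^ i) x * (ad d ^^ (n - i)) y)) \<in> C"
proof -
  have "(ad d ^^ i) u \<in> C" if "u \<in> C" for i u
    using assms(2) that by (induction i) (auto simp: lie_idealiser_def ad_def)
  then show ?thesis
    using assms unfolding rat_subalgebra_def by (intro subspace_sum subspace_scale) auto
qed

lemma subspace_sym_space:
  assumes "subspace C"
  shows "subspace (sym_space scale C d k)"
proof (rule subspaceI)
  show "0 \<in> sym_space scale C d k"
    unfolding sym_space_def using subspace_0[OF assms] sym_term_0 by force
  show "u + v \<in> sym_space scale C d k"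
    if "u \<in> sym_space scale C d k" "v \<in> sym_space scale C d k" for u v
    using that subspace_add[OF assms] unfolding sym_space_def by (auto simp flip: sym_term_add)
  show "scale r u \<in> sym_space scale C d k" if "u \<in> sym_space scale C d k" for r u
    using that subspace_scale[OF assms] unfolding sym_space_def by (auto simp flip: sym_term_scale)
qed

text \<open>As a span, the sum of the spaces can be tested for closure under products on single
  symmetric terms.\<close>

lemma sym_sum_eq_span:
  assumes "subspace C"
  shows "sym_sum scale C d = span (\<Union>k. sym_space scale C d k)"
proof
  show "sym_sum scale C d \<subseteq> span (\<Union>k. sym_space scale C d k)"
    unfolding sym_sum_def by (auto intro!: span_sum intro: span_base)
next
  \<comment> \<open>Any finite index set containing the support may be used; the support of a sum of
    two families can be smaller than the union of their supports.\<close>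
  have memI: "sum f A \<in> sym_sum scale C d"
    if "finite A" "\<And>k. f k \<in> sym_space scale C d k" "\<And>k. k \<notin> A \<Longrightarrow> f k = 0" for f A
  proof -
    have "{k. f k \<noteq> 0} \<subseteq> A" using that by auto
    then have "finite {k. f k \<noteq> 0}" "sum f A = (\<Sum>k | f k \<noteq> 0. f k)"
      using \<open>finite A\<close> by (auto intro: finite_subset sum.mono_neutral_right)
    with that show ?thesis
      unfolding sym_sum_def by auto
  qed
  have "subspace (sym_sum scale C d)"
  proof (rule subspaceI)
    show "0 \<in> sym_sum scale C d"
      using memI[of "{}" "\<lambda>_. 0"] subspace_0[OF subspace_sym_space[OF assms]] by simp
  next
    fix u v assume "u \<in> sym_sum scale C d" "v \<in> sym_sum scale C d"
    then obtain f g where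
      f: "\<And>k. f k \<in> sym_space scale C d k" "finite {k. f k \<noteq> 0}" "u = (\<Sum>k | f k \<noteq> 0. f k)" and
      g: "\<And>k. g k \<in> sym_space scale C d k" "finite {k. g k \<noteq> 0}" "v = (\<Sum>k | g k \<noteq> 0. g k)"
      unfolding sym_sum_def by blast
    let ?A = "{k. f k \<noteq> 0} \<union> {k. g k \<noteq> 0}"
    have "u = sum f ?A" "v = sum g ?A"
      using f g by (auto intro!: sum.mono_neutral_left)
    then show "u + v \<in> sym_sum scale C d"
      using memI[of ?A "\<lambda>k. f k + g k"] f g subspace_add[OF subspace_sym_space[OF assms]]
      by (simp add: sum.distrib)
  next
    fix r u assume "u \<in> sym_sum scale C d"
    then obtain f where
      f: "\<And>k. f k \<in> sym_space scale C d k" "finite {k. f k \<noteq> 0}" "u = (\<Sum>k | f k \<noteq> 0. f k)"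
      unfolding sym_sum_def by blast
    then show "scale r u \<in> sym_sum scale C d"
      using memI[of "{k. f k \<noteq> 0}" "\<lambda>k. scale r (f k)"]
        subspace_scale[OF subspace_sym_space[OF assms]]
      by (simp add: scale_sum_right)
  qed
  moreover have "sym_space scale C d k \<subseteq> sym_sum scale C d" for k
  proof
    fix u assume "u \<in> sym_space scale C d k"
    then show "u \<in> sym_sum scale C d"
      using memI[of "{k}" "\<lambda>j. if j = k then u else 0"]
        subspace_0[OF subspace_sym_space[OF assms]] by auto
  qed
  ultimately show "span (\<Union>k. sym_space scale C d k) \<subseteq> sym_sum scale C d"
    by (intro span_minimal) auto
qed

text \<open>The product is bilinear, so closure extends from generators to the span, one factor at a
  time.\<close>

lemma span_mult_closed:
  assumes "\<And>u v. u \<in> S \<Longrightarrow> v \<in> S \<Longrightarrow> u * v \<in> span S"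
    and "a \<in> span S" "b \<in> span S"
  shows "a * b \<in> span S"
  using assms(2)
proof (induction rule: span_induct_alt)
  case base
  show ?case by (simp add: span_zero)
next
  case (step r u a)
  have "u * b \<in> span S"
    using assms(3)
  proof (induction rule: span_induct_alt)
    case base
    show ?case by (simp add: span_zero)
  next
    case inner: (step s v b)
    then show ?case
      using assms(1)[OF step(1)]
      by (simp add: distrib_left scale_mult_right span_add span_scale)
  qed
  then show ?case
    using step by (simp add: distrib_right scale_mult_left span_add span_scale)
qed

end

theorem lemma1:
  fixes scale :: "rat \<Rightarrow> 'a::ring_1 \<Rightarrow> 'a" and C :: "'a set" and d :: 'a
  assumes "rat_algebra scale"
    and "commutative_subalgebra scale C"
    and "d \<in> lie_idealiser C - C"
  shows "rat_subalgebra scale (sym_sum scale C d) \<and>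
    (\<exists>\<pi> :: nat \<Rightarrow> nat \<Rightarrow> nat \<Rightarrow> nat \<Rightarrow> rat.
       \<forall>x\<in>C. \<forall>y\<in>C. \<forall>k l.
         let z = (\<lambda>n. \<Sum>i\<le>n. scale (\<pi> k l n i) ((ad d ^^ i) x * (ad d ^^ (n - i)) y)) in
           (\<forall>n\<le>k + l. z n \<in> C) \<and>
           sym_term scale d x k * sym_term scale d y l =
             (\<Sum>n\<le>k + l. sym_term scale d (z n) (k + l - n)))"
proof -
  interpret rat_algebra scale by fact
  have C: "rat_subalgebra scale C" and d: "d \<in> lie_idealiser C"
    using assms by (auto simp: commutative_subalgebra_def)
  then have sub: "subspace C"
    by (simp add: rat_subalgebra_def)
  obtain \<pi> where prod: "\<And>k l x y. sym_term scale d x k * sym_term scale d y l =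
    (\<Sum>n\<le>k + l. sym_term scale d
      (\<Sum>i\<le>n. scale (\<pi> k l n i) ((ad d ^^ i) x * (ad d ^^ (n - i)) y)) (k + l - n))"
    using sym_term_prod_expansion by blast
  have "u * v \<in> span (\<Union>k. sym_space scale C d k)"
    if words: "u \<in> (\<Union>k. sym_space scale C d k)" "v \<in> (\<Union>k. sym_space scale C d k)" for u v
  proof -
    obtain x k y l where xy: "x \<in> C" "y \<in> C"
      and uv: "u = sym_term scale d x k" "v = sym_term scale d y l"
      using words unfolding sym_space_def by blast
    \<comment> \<open>By the expansion, the product is a sum of symmetric terms of the elements
      \<open>z n\<close>, and these lie in \<open>C\<close>.\<close>
    show ?thesis
      unfolding uv prod using diff_form_mem[OF C d xy]
      by (intro span_sum span_base) (auto simp: sym_space_def)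
  qed
  then have "rat_subalgebra scale (sym_sum scale C d)"
    unfolding rat_subalgebra_def sym_sum_eq_span[OF sub]
    using span_mult_closed subspace_span by blast
  moreover have "\<forall>x\<in>C. \<forall>y\<in>C. \<forall>k l.
      let z = (\<lambda>n. \<Sum>i\<le>n. scale (\<pi> k l n i) ((ad d ^^ i) x * (ad d ^^ (n - i)) y)) in
        (\<forall>n\<le>k + l. z n \<in> C) \<and>
        sym_term scale d x k * sym_term scale d y l =
          (\<Sum>n\<le>k + l. sym_term scale d (z n) (k + l - n))"
    unfolding Let_def using diff_form_mem[OF C d] prod by blast
  ultimately show ?thesis
    by blast
qed

end
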